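(* Let $(\mathsf{Seq}(\mathscr{L},\Rightarrow),\vdash)$ be a normal sequent structure and let $T$ be a rule of it that is disjoint from the weakening and exchange rules. Suppose that for every provable sequent $\Gamma\Rightarrow\Delta$ the following hold. (1) If $\Gamma$ is not the empty list, then there exist a rule $R$ and a sequent $\Gamma^R\Rightarrow\Delta^R$ that is deducible, by an application of the rule $R$, from a set of sequents which includes $\Gamma\Rightarrow\Delta$ as one of the premises. If $\Delta$ is not the empty list, then there exist a rule $L$ and a sequent $\Gamma^L\Rightarrow\Delta^L$ that is deducible, by an application of the rule $L$, from a set of sequents which includes $\Gamma\Rightarrow\Delta$ as one of the premises. Furthermore, each of the premises (in these applications of $R$ and $L$) is provable. (2) If there exists a proof of $\Gamma^R\Rightarrow\Delta^R$, then there exists a $T$-free proof of $\Gamma\Rightarrow\Delta$; similarly, if there exists a proof of $\Gamma^L\Rightarrow\Delta^L$, then there exists a $T$-free proof of $\Gamma\Rightarrow\Delta$. Then every provable sequent has a $T$-free proof.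
   Context: Sequents. For a set $\mathscr{L}$, let $\boldsymbol{FO}(\mathscr{L})$ be the set of finite ordered lists of elements of $\mathscr{L}$, and let $\Rightarrow\,\subseteq\boldsymbol{FO}(\mathscr{L})\times\boldsymbol{FO}(\mathscr{L})$. A sequent is a pair $(\Gamma,\Delta)\in\,\Rightarrow$, written $\Gamma\Rightarrow\Delta$; $\mathsf{Seq}(\mathscr{L},\Rightarrow)$ is the set of all sequents. Rules. A rule is a nonempty set $R\subseteq\mathsf{Seq}(\mathscr{L},\Rightarrow)^n\times\mathsf{Seq}(\mathscr{L},\Rightarrow)$ for some $n\in\mathbb{N}=\{0,1,\ldots\}$. It is axiomatic if $\emptyset\subsetneq R\subseteq\{\emptyset\}\times\mathsf{Seq}(\mathscr{L},\Rightarrow)$, and non-axiomatic otherwise. An element $((S_1,\ldots,S_n),S)\in R$ is an instance (application) of $R$, with premises $S_1,\ldots,S_n$ and conclusion $S$. The weakening rules are WL (from $\Gamma\Rightarrow\Delta$ infer $A,\Gamma\Rightarrow\Delta$) and WR (from $\Gamma\Rightarrow\Delta$ infer $\Gamma\Rightarrow\Delta,A$); the exchange rules are EL (from $\Gamma,A,B,\Pi\Rightarrow\Delta$ infer $\Gamma,B,A,\Pi\Rightarrow\Delta$) and ER (from $\Gamma\Rightarrow\Delta,A,B,\Sigma$ infer $\Gamma\Rightarrow\Delta,B,A,\Sigma$). Normal sequent structure. Let $\mathscr{L}$ be the formula algebra (set of formulas) built inductively over a nonempty set $V$ of variables with a finite set of connectives, equipped with a set of rules, and let $\vdash\,\subseteq\mathcal{P}(\mathsf{Seq}(\mathscr{L},\Rightarrow))\times\mathsf{Seq}(\mathscr{L},\Rightarrow)$.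 The pair $(\mathsf{Seq}(\mathscr{L},\Rightarrow),\vdash)$ is a normal sequent structure if: (i) $p\Rightarrow p$ for all $p\in V$, and $\emptyset\vdash p\Rightarrow p$ for all $p\in V$; (ii) the weakening and exchange rules are included in the set of rules; (iii) $\emptyset\vdash\Gamma\Rightarrow\Delta$ means that $\Gamma\Rightarrow\Delta$ is provable, i.e. has a proof: a finite tree of sequents with root $\Gamma\Rightarrow\Delta$, whose leaves are conclusions of instances of axiomatic rules and in which each other node is the conclusion of an instance of a rule with the children of the node as premises; (iv) if $\Gamma\Rightarrow\Delta$ is provable and $\Gamma,\Delta$ both contain only variables, then some $p\in V$ is common to both lists $\Gamma$ and $\Delta$; (v) if $\Gamma\Rightarrow\Delta$ is provable, then $\Gamma$ is not the empty list or $\Delta$ is not the empty list. The rules $R,L,T$ in the claim are from the set of rules of the structure. A proof is $T$-free if it contains no application of $T$. *)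

theory Defs
  imports Main
begin

section \<open>Formulas\<close>

datatype ('v, 'c) formula = Var 'v | Conn 'c "('v, 'c) formula list"

inductive_set formulas :: "'v set \<Rightarrow> 'c set \<Rightarrow> ('c \<Rightarrow> nat) \<Rightarrow> ('v, 'c) formula set"
  for V :: "'v set" and C :: "'c set" and ar :: "'c \<Rightarrow> nat"
where
  Var: "p \<in> V \<Longrightarrow> Var p \<in> formulas V C ar"
| Conn: "c \<in> C \<Longrightarrow> length As = ar c \<Longrightarrow> (\<And>A. A \<in> set As \<Longrightarrow> A \<in> formulas V C ar)
    \<Longrightarrow> Conn c As \<in> formulas V C ar"

section \<open>Sequents and rules\<close>

type_synonym 'f sequent = "'f list \<times> 'f list"

text \<open>An inference is the list of its premises paired with its conclusion; a rule is the set of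
  its instances.\<close>

type_synonym 'f inference = "'f sequent list \<times> 'f sequent"
type_synonym 'f rule = "'f inference set"

text \<open>Throughout, \<open>Sq\<close> is the relation \<open>\<Rightarrow>\<close>, so that a pair of lists is a sequent iff it lies
  in \<open>Sq\<close>.\<close>

definition is_rule :: "'f sequent set \<Rightarrow> 'f rule \<Rightarrow> bool" where
  "is_rule Sq R \<longleftrightarrow>
     R \<noteq> {} \<and> (\<exists>n. R \<subseteq> {ps. set ps \<subseteq> Sq \<and> length ps = n} \<times> Sq)"

definition axiomatic :: "'f sequent set \<Rightarrow> 'f rule \<Rightarrow> bool" where
  "axiomatic Sq R \<longleftrightarrow> {} \<subset> R \<and> R \<subseteq> {[]} \<times> Sq"

text \<open>The structural rules consist of all instances of the respective schema whose premise and
  conclusion are both sequents; \<open>Sq\<close> need not be all of \<open>lists L \<times> lists L\<close>.\<close>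

definition weakening_left :: "'f set \<Rightarrow> 'f sequent set \<Rightarrow> 'f rule" where
  "weakening_left L Sq =
     {([(\<Gamma>, \<Delta>)], (A # \<Gamma>, \<Delta>)) |A \<Gamma> \<Delta>.
        A \<in> L \<and> (\<Gamma>, \<Delta>) \<in> Sq \<and> (A # \<Gamma>, \<Delta>) \<in> Sq}"

definition weakening_right :: "'f set \<Rightarrow> 'f sequent set \<Rightarrow> 'f rule" where
  "weakening_right L Sq =
     {([(\<Gamma>, \<Delta>)], (\<Gamma>, \<Delta> @ [A])) |A \<Gamma> \<Delta>.
        A \<in> L \<and> (\<Gamma>, \<Delta>) \<in> Sq \<and> (\<Gamma>, \<Delta> @ [A]) \<in> Sq}"

definition exchange_left :: "'f sequent set \<Rightarrow> 'f rule" where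
  "exchange_left Sq =
     {([(\<Gamma> @ [A, B] @ \<Pi>, \<Delta>)], (\<Gamma> @ [B, A] @ \<Pi>, \<Delta>)) |A B \<Gamma> \<Pi> \<Delta>.
        (\<Gamma> @ [A, B] @ \<Pi>, \<Delta>) \<in> Sq \<and> (\<Gamma> @ [B, A] @ \<Pi>, \<Delta>) \<in> Sq}"

definition exchange_right :: "'f sequent set \<Rightarrow> 'f rule" where
  "exchange_right Sq =
     {([(\<Gamma>, \<Delta> @ [A, B] @ \<Sigma>)], (\<Gamma>, \<Delta> @ [B, A] @ \<Sigma>)) |A B \<Gamma> \<Delta> \<Sigma>.
        (\<Gamma>, \<Delta> @ [A, B] @ \<Sigma>) \<in> Sq \<and> (\<Gamma>, \<Delta> @ [B, A] @ \<Sigma>) \<in> Sq}"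

definition structural_rules :: "'f set \<Rightarrow> 'f sequent set \<Rightarrow> 'f rule set" where
  "structural_rules L Sq =
     {weakening_left L Sq, weakening_right L Sq, exchange_left Sq, exchange_right Sq}"

section \<open>Proofs\<close>

datatype 'f proof_tree = Node (root: "'f sequent") (children: "'f proof_tree list")

fun is_proof :: "'f sequent set \<Rightarrow> 'f rule set \<Rightarrow> 'f proof_tree \<Rightarrow> bool" where
  "is_proof Sq Rules (Node S ts) \<longleftrightarrow>
     (if ts = [] then \<exists>R \<in> Rules. axiomatic Sq R \<and> ([], S) \<in> R
      else \<exists>R \<in> Rules. (map root ts, S) \<in> R) \<and>
     (\<forall>t \<in> set ts. is_proof Sq Rules t)"

text \<open>Rules are sets of instances and may overlap, so nodes carry no rule name: an inference
  counts as an application of every rule that contains it.\<close>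

fun inferences :: "'f proof_tree \<Rightarrow> 'f inference set" where
  "inferences (Node S ts) = insert (map root ts, S) (\<Union>t \<in> set ts. inferences t)"

definition rule_free :: "'f rule \<Rightarrow> 'f proof_tree \<Rightarrow> bool" where
  "rule_free T t \<longleftrightarrow> inferences t \<inter> T = {}"

definition provable :: "'f sequent set \<Rightarrow> 'f rule set \<Rightarrow> 'f sequent \<Rightarrow> bool" where
  "provable Sq Rules S \<longleftrightarrow> (\<exists>t. is_proof Sq Rules t \<and> root t = S)"

definition provable_without :: "'f rule \<Rightarrow> 'f sequent set \<Rightarrow> 'f rule set \<Rightarrow> 'f sequent \<Rightarrow> bool" where
  "provable_without T Sq Rules S \<longleftrightarrow>
     (\<exists>t. is_proof Sq Rules t \<and> root t = S \<and> rule_free T t)"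

section \<open>Normal sequent structures\<close>

locale normal_sequent_structure =
  fixes V :: "'v set"
    and C :: "'c set"
    and ar :: "'c \<Rightarrow> nat"
    and Sq :: "('v, 'c) formula sequent set"
    and Rules :: "('v, 'c) formula rule set"
    and entails :: "(('v, 'c) formula sequent set \<times> ('v, 'c) formula sequent) set"
  assumes V_nonempty: "V \<noteq> {}"
    and C_finite: "finite C"
    and Sq_subset: "Sq \<subseteq> lists (formulas V C ar) \<times> lists (formulas V C ar)"
    and rules: "\<And>R. R \<in> Rules \<Longrightarrow> is_rule Sq R"
    and entails_subset: "entails \<subseteq> Pow Sq \<times> Sq"
    and var_sequent: "\<And>p. p \<in> V \<Longrightarrow> ([Var p], [Var p]) \<in> Sq"
    and var_entailed: "\<And>p. p \<in> V \<Longrightarrow> ({}, ([Var p], [Var p])) \<in> entails"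
    and structural: "structural_rules (formulas V C ar) Sq \<subseteq> Rules"
    and entails_empty_iff: "\<And>S. S \<in> Sq \<Longrightarrow> ({}, S) \<in> entails \<longleftrightarrow> provable Sq Rules S"
    and common_variable: "\<And>\<Gamma> \<Delta>. provable Sq Rules (\<Gamma>, \<Delta>) \<Longrightarrow> set \<Gamma> \<subseteq> Var ` V \<Longrightarrow>
      set \<Delta> \<subseteq> Var ` V \<Longrightarrow> \<exists>p \<in> V. Var p \<in> set \<Gamma> \<and> Var p \<in> set \<Delta>"
    and nonempty_side: "\<And>\<Gamma> \<Delta>. provable Sq Rules (\<Gamma>, \<Delta>) \<Longrightarrow> \<Gamma> \<noteq> [] \<or> \<Delta> \<noteq> []"

end

theory Submission
  imports Defs
begin

text \<open>
  The hypothesis hands out, for a provable sequent with a nonempty side, a one-step extension of its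
  proof whose provability already yields a proof avoiding \<open>T\<close>. All premises of that
  extending inference are provable, and grafting their proofs below it proves its conclusion
  (\<open>provable_by_inference\<close>), so the condition is always met. The only sequent for
  which no extension would be available is the empty one, and in a normal sequent structure it is
  not provable.
\<close>

text \<open>
  A node without children must be an instance of an axiomatic rule, whereas an inference without
  premises may belong to a rule that is not axiomatic for \<open>Sq\<close>; hence the demand that there
  be at least one premise.
\<close>

lemma provable_by_inference:
  assumes "R \<in> Rules" and "(ps, S) \<in> R" and "ps \<noteq> []"
    and "\<forall>P \<in> set ps. provable Sq Rules P"
  shows "provable Sq Rules S"
proof -
  obtain f where f: "\<forall>P \<in> set ps. is_proof Sq Rules (f P) \<and> root (f P) = P"
    using assms(4) unfolding provable_def by metis
  then have "map root (map f ps) = ps"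
    by (simp add: map_idI)
  with f assms(1-3) have "is_proof Sq Rules (Node S (map f ps))"
    by auto
  then show ?thesis
    unfolding provable_def by (metis proof_tree.sel(1))
qed

theorem theorem3p7:
  fixes V :: "'v set" and C :: "'c set" and ar :: "'c \<Rightarrow> nat"
    and Sq :: "('v, 'c) formula sequent set"
    and Rules :: "('v, 'c) formula rule set"
    and entails :: "(('v, 'c) formula sequent set \<times> ('v, 'c) formula sequent) set"
    and T :: "('v, 'c) formula rule"
  assumes "normal_sequent_structure V C ar Sq Rules entails"
    and "T \<in> Rules"
    and "\<forall>W \<in> structural_rules (formulas V C ar) Sq. T \<inter> W = {}"
    and "\<And>\<Gamma> \<Delta>. provable Sq Rules (\<Gamma>, \<Delta>) \<Longrightarrow>
      (\<Gamma> \<noteq> [] \<longrightarrow>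
        (\<exists>R \<in> Rules. \<exists>ps \<Gamma>R \<Delta>R.
           (ps, (\<Gamma>R, \<Delta>R)) \<in> R \<and> (\<Gamma>, \<Delta>) \<in> set ps \<and> (\<forall>S \<in> set ps. provable Sq Rules S) \<and>
           (provable Sq Rules (\<Gamma>R, \<Delta>R) \<longrightarrow> provable_without T Sq Rules (\<Gamma>, \<Delta>)))) \<and>
      (\<Delta> \<noteq> [] \<longrightarrow>
        (\<exists>L \<in> Rules. \<exists>ps \<Gamma>L \<Delta>L.
           (ps, (\<Gamma>L, \<Delta>L)) \<in> L \<and> (\<Gamma>, \<Delta>) \<in> set ps \<and> (\<forall>S \<in> set ps. provable Sq Rules S) \<and>
           (provable Sq Rules (\<Gamma>L, \<Delta>L) \<longrightarrow> provable_without T Sq Rules (\<Gamma>, \<Delta>))))"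
  shows "\<forall>S. provable Sq Rules S \<longrightarrow> provable_without T Sq Rules S"
proof (intro allI impI)
  fix S assume prov: "provable Sq Rules S"
  obtain \<Gamma> \<Delta> where S: "S = (\<Gamma>, \<Delta>)"
    by (cases S)
  have "\<Gamma> \<noteq> [] \<or> \<Delta> \<noteq> []"
    using normal_sequent_structure.nonempty_side[OF assms(1)] prov S by blast
  then obtain R ps S' where "R \<in> Rules" "(ps, S') \<in> R" "S \<in> set ps"
      "\<forall>P \<in> set ps. provable Sq Rules P"
      and T_free: "provable Sq Rules S' \<longrightarrow> provable_without T Sq Rules S"
    using assms(4)[of \<Gamma> \<Delta>] prov S by metis
  then have "provable Sq Rules S'"
    by (metis provable_by_inference empty_iff list.set(1))
  with T_free show "provable_without T Sq Rules S"
    by blast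
qed

end
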